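(* Let $X$ be a Banach space, let $C\subseteq X$ be a bounded, convex, non-empty, non-singleton set, let $x\in C$, and let $\mathcal{M}=\mathcal{M}(C)$ denote the space of non-expansive mappings $C\to C$ equipped with the supremum metric. Then the set $$\mathcal{V}_{x}:=\{f\in\mathcal{M}\colon \operatorname{Lip}(f,x)<1\}$$ is $\sigma$-lower porous in $\mathcal{M}$.
   Context: A mapping $f\colon C\to C$ is non-expansive if $\|f(y)-f(x)\|\le\|y-x\|$ for all $x,y\in C$. $\mathcal{M}(C)$ is the set of all non-expansive mappings $C\to C$, with metric $d_\infty(f,g)=\|g-f\|_\infty=\sup_{x\in C}\|g(x)-f(x)\|$. For $f\colon C\to C$ and $x\in C$, $$\operatorname{Lip}(f,x):=\lim_{r\to 0}\sup\left\{\frac{\|f(y)-f(x)\|}{\|y-x\|}\colon y\in C,\ 0<\|y-x\|\le r\right\}.$$ Porosity: for a metric space $(M,d)$, $P\subseteq M$, $x\in M$, $r>0$, let $B_M(x,r)$ be the open ball and $$\gamma(x,r,P):=\sup\{s>0\colon \exists x'\in M\text{ such that }B_M(x',s)\subseteq B_M(x,r)\setminus P\},$$ with $\sup\emptyset=-\infty$. $P$ is lower porous at $x$ if $\gamma(x,r,P)>0$ for all $r>0$ and $\liminf_{r\to 0}\gamma(x,r,P)/r>0$. $P$ is lower porous if it is lower porous at every $x\in P$. A set is $\sigma$-lower porous if it is a countable union of lower porous sets. *)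

theory Defs
  imports "HOL-Analysis.Analysis"
begin

subsection \<open>Non-expansive mappings\<close>

text \<open>Self-mappings of \<open>C\<close> are represented by functions that are \<open>undefined\<close> outside \<open>C\<close>, so that
  equality of mappings is equality on \<open>C\<close>.\<close>

definition nonexpansive_maps :: "'a::real_normed_vector set \<Rightarrow> ('a \<Rightarrow> 'a) set" where
  "nonexpansive_maps C =
     {f \<in> C \<rightarrow>\<^sub>E C. \<forall>x\<in>C. \<forall>y\<in>C. norm (f y - f x) \<le> norm (y - x)}"

text \<open>The library's \<open>funspace C\<close> consists of all bounded functions on \<open>C\<close> with the supremum metric.
  The submetric has carrier \<open>nonexpansive_maps C\<close> whenever \<open>C\<close> is bounded; see
  \<open>mspace_nonexpansive_space\<close> and \<open>mdist_nonexpansive_space\<close>.\<close>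

definition nonexpansive_space :: "'a::real_normed_vector set \<Rightarrow> ('a \<Rightarrow> 'a) metric" where
  "nonexpansive_space C = submetric (funspace C euclidean_metric) (nonexpansive_maps C)"

lemma nonexpansive_maps_subset_fspace:
  assumes "bounded C"
  shows "nonexpansive_maps C \<subseteq> mspace (funspace C euclidean_metric)"
proof
  fix f assume f: "f \<in> nonexpansive_maps C"
  then have "f ` C \<subseteq> C" "f \<in> extensional C"
    by (auto simp: nonexpansive_maps_def PiE_def)
  moreover from this have "bounded (f ` C)"
    using assms bounded_subset by blast
  ultimately show "f \<in> mspace (funspace C euclidean_metric)"
    by (simp add: Met_TC.fspace_def)
qed

lemma mspace_nonexpansive_space:
  assumes "bounded C"
  shows "mspace (nonexpansive_space C) = nonexpansive_maps C"
  using nonexpansive_maps_subset_fspace[OF assms]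
  by (auto simp: nonexpansive_space_def)

lemma mdist_nonexpansive_space:
  assumes "bounded C" "C \<noteq> {}" "f \<in> nonexpansive_maps C" "g \<in> nonexpansive_maps C"
  shows "mdist (nonexpansive_space C) f g = (SUP x\<in>C. norm (g x - f x))"
  using nonexpansive_maps_subset_fspace[OF assms(1)] assms
  by (auto simp: nonexpansive_space_def Met_TC.fdist_def dist_norm norm_minus_commute)

subsection \<open>Pointwise Lipschitz constant\<close>

definition Lip_quot_sup :: "'a::real_normed_vector set \<Rightarrow> ('a \<Rightarrow> 'a) \<Rightarrow> 'a \<Rightarrow> real \<Rightarrow> ereal" where
  "Lip_quot_sup C f x r =
     Sup {ereal (norm (f y - f x) / norm (y - x)) | y. y \<in> C \<and> 0 < norm (y - x) \<and> norm (y - x) \<le> r}"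

text \<open>Extended-real valued, since the quotients of an arbitrary self-mapping may be unbounded.
  The limit always exists by monotonicity in \<open>r\<close>; see the lemma \<open>tendsto_Lip\<close>.\<close>

definition Lip :: "'a::real_normed_vector set \<Rightarrow> ('a \<Rightarrow> 'a) \<Rightarrow> 'a \<Rightarrow> ereal" where
  "Lip C f x = Lim (at_right 0) (Lip_quot_sup C f x)"

lemma tendsto_Lip: "(Lip_quot_sup C f x \<longlongrightarrow> Lip C f x) (at_right 0)"
proof -
  let ?S = "Lip_quot_sup C f x"
  have mono: "?S r \<le> ?S s" if "r \<le> s" for r s
    unfolding Lip_quot_sup_def using that by (intro Sup_subset_mono) force
  have "(?S \<longlongrightarrow> (INF r\<in>{0<..}. ?S r)) (at_right 0)"
  proof (rule order_tendstoI)
    fix a assume "a < (INF r\<in>{0<..}. ?S r)"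
    then have "a < ?S r" if "0 < r" for r
      using that by (meson INF_lower greaterThan_iff less_le_trans)
    then show "\<forall>\<^sub>F r in at_right 0. a < ?S r"
      by (auto simp: eventually_at_right_field intro: exI[of _ 1])
  next
    fix a assume "(INF r\<in>{0<..}. ?S r) < a"
    then obtain s where "0 < s" "?S s < a"
      by (auto simp: INF_less_iff)
    then show "\<forall>\<^sub>F r in at_right 0. ?S r < a"
      unfolding eventually_at_right_field
      by (meson mono le_less_trans less_imp_le)
  qed
  then show ?thesis
    unfolding Lip_def by (metis tendsto_Lim trivial_limit_at_right_real)
qed

subsection \<open>Lower porosity\<close>

text \<open>In the extended reals the supremum of the empty set is \<open>- \<infinity>\<close>.\<close>

definition porosity_gamma :: "'a metric \<Rightarrow> 'a \<Rightarrow> real \<Rightarrow> 'a set \<Rightarrow> ereal" where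
  "porosity_gamma m x r P =
     Sup {ereal s | s. 0 < s \<and> (\<exists>x'\<in>mspace m. mball_of m x' s \<subseteq> mball_of m x r - P)}"

definition lower_porous_at :: "'a metric \<Rightarrow> 'a set \<Rightarrow> 'a \<Rightarrow> bool" where
  "lower_porous_at m P x \<longleftrightarrow>
     (\<forall>r>0. porosity_gamma m x r P > 0) \<and>
     Liminf (at_right 0) (\<lambda>r. porosity_gamma m x r P / ereal r) > 0"

definition lower_porous :: "'a metric \<Rightarrow> 'a set \<Rightarrow> bool" where
  "lower_porous m P \<longleftrightarrow> P \<subseteq> mspace m \<and> (\<forall>x\<in>P. lower_porous_at m P x)"

definition sigma_lower_porous :: "'a metric \<Rightarrow> 'a set \<Rightarrow> bool" where
  "sigma_lower_porous m P \<longleftrightarrow> (\<exists>\<Q>. countable \<Q> \<and> (\<forall>Q\<in>\<Q>. lower_porous m Q) \<and> P = \<Union>\<Q>)"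

end

theory Submission
  imports Defs
begin

text \<open>Given \<open>f\<close> and a small radius \<open>R\<close>, first compose \<open>f\<close> with the map
  \<open>y \<mapsto> x + max 0 (1 - R / \<parallel>y - x\<parallel>) (y - x)\<close>. This map is non-expansive in every normed space,
  moves points by at most \<open>R\<close>, and collapses the ball of radius \<open>R\<close> about \<open>x\<close> to \<open>x\<close>. The composition
  leaves just enough room to add the cone \<open>max 0 (R - \<parallel>y - x\<parallel>) v\<close>, where \<open>v\<close> is a unit vector
  pointing from \<open>f x\<close> into \<open>C\<close>, without losing non-expansiveness. The resulting map is within \<open>2R\<close> of
  \<open>f\<close> and has difference quotient exactly \<open>1\<close> between \<open>x\<close> and every point at distance \<open>R\<close>, so
  all maps within a fixed fraction of \<open>R\<close> of it have a quotient close to \<open>1\<close> at scale \<open>R\<close>.\<close>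

text \<open>Holes of relative size \<open>c\<close> at every small scale give the liminf bound
  directly. Since \<open>porosity_gamma\<close> is monotone in the radius, positivity at a large
  \<open>r\<close> follows from positivity at \<open>min r r0\<close>.\<close>

lemma lower_porous_atI:
  fixes m :: "'a metric"
  assumes "0 < c" "0 < r0"
    and ball: "\<And>r. 0 < r \<Longrightarrow> r \<le> r0 \<Longrightarrow>
      \<exists>x'\<in>mspace m. mball_of m x' (c * r) \<subseteq> mball_of m x r - P"
  shows "lower_porous_at m P x"
proof -
  have small: "ereal (c * r) \<le> porosity_gamma m x r P" if "0 < r" "r \<le> r0" for r
    unfolding porosity_gamma_def using ball[OF that] that \<open>0 < c\<close> by (intro Sup_upper) auto
  have mono: "porosity_gamma m x r P \<le> porosity_gamma m x s P" if "r \<le> s" for r s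
  proof -
    have "mball_of m x r \<subseteq> mball_of m x s"
      using that by auto
    then show ?thesis
      unfolding porosity_gamma_def by (intro Sup_subset_mono) blast
  qed
  have pos: "porosity_gamma m x r P > 0" if "r > 0" for r
  proof -
    have "0 < ereal (c * min r r0)"
      using that assms by simp
    also have "\<dots> \<le> porosity_gamma m x (min r r0) P"
      using that assms by (intro small) auto
    also have "\<dots> \<le> porosity_gamma m x r P"
      by (intro mono) simp
    finally show ?thesis .
  qed
  have "ereal c \<le> porosity_gamma m x r P / ereal r" if "0 < r" "r < r0" for r
    using small[of r] that by (simp add: ereal_le_divide_pos mult.commute)
  then have "\<forall>\<^sub>F r in at_right 0. ereal c \<le> porosity_gamma m x r P / ereal r"
    unfolding eventually_at_right_field using \<open>0 < r0\<close> by blast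
  then have "ereal c \<le> Liminf (at_right 0) (\<lambda>r. porosity_gamma m x r P / ereal r)"
    by (rule Liminf_bounded)
  then have "Liminf (at_right 0) (\<lambda>r. porosity_gamma m x r P / ereal r) > 0"
    using \<open>0 < c\<close> by (meson ereal_less(2) less_le_trans)
  with pos show ?thesis
    unfolding lower_porous_at_def by blast
qed

section \<open>Supremum metric versus pointwise distances\<close>

lemma norm_le_mdist_nonexpansive_space:
  assumes "bounded C" "f \<in> nonexpansive_maps C" "g \<in> nonexpansive_maps C" "y \<in> C"
  shows "norm (g y - f y) \<le> mdist (nonexpansive_space C) f g"
proof -
  have "f ` C \<subseteq> C" "g ` C \<subseteq> C"
    using assms by (auto simp: nonexpansive_maps_def)
  \<comment> \<open>A real-valued \<open>SUP\<close> dominates its members only if they are bounded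
    above; boundedness of \<open>C\<close> provides this.\<close>
  then have "bounded ((\<lambda>x. g x - f x) ` C)"
    using bounded_subset[OF assms(1)] by (intro bounded_minus_comp) auto
  then have "bdd_above ((\<lambda>x. norm (g x - f x)) ` C)"
    by (simp add: image_image flip: bdd_above_norm)
  then have "norm (g y - f y) \<le> (SUP x\<in>C. norm (g x - f x))"
    using \<open>y \<in> C\<close> by (rule cSUP_upper2[OF _ _ order_refl])
  with assms show ?thesis
    by (subst mdist_nonexpansive_space) auto
qed

lemma mdist_nonexpansive_space_le:
  assumes "bounded C" "C \<noteq> {}" "f \<in> nonexpansive_maps C" "g \<in> nonexpansive_maps C"
    and "\<And>y. y \<in> C \<Longrightarrow> norm (g y - f y) \<le> K"
  shows "mdist (nonexpansive_space C) f g \<le> K"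
  using assms by (simp add: mdist_nonexpansive_space cSUP_least)

section \<open>Radial shrinking and the cone perturbation\<close>

definition shrink :: "real \<Rightarrow> 'a::real_normed_vector \<Rightarrow> 'a" where
  "shrink R y = max 0 (1 - R / norm y) *\<^sub>R y"

lemma norm_shrink:
  assumes "R > 0"
  shows "norm (shrink R y) = max 0 (norm y - R)"
  \<comment> \<open>At \<open>y = 0\<close> the convention \<open>R / 0 = 0\<close> makes the factor
    1, which is harmless because the scaled vector is zero.\<close>
  using assms by (cases "y = 0") (auto simp: shrink_def max_def field_simps)

lemma shrink_eq_0: "R > 0 \<Longrightarrow> norm y \<le> R \<Longrightarrow> shrink R y = 0"
  using norm_shrink[of R y] by simp

lemma shrink_eq: "R > 0 \<Longrightarrow> R \<le> norm y \<Longrightarrow> shrink R y = (1 - R / norm y) *\<^sub>R y"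
  by (cases "y = 0") (simp_all add: shrink_def)

lemma norm_shrink_diff_self:
  assumes "R > 0"
  shows "norm (shrink R y - y) \<le> R"
proof (cases "norm y \<le> R")
  case True
  then show ?thesis
    using assms by (simp add: shrink_eq_0)
next
  case False
  then have "shrink R y - y = (- (R / norm y)) *\<^sub>R y"
    using assms by (simp add: shrink_eq algebra_simps)
  then show ?thesis
    using False assms by simp
qed

text \<open>By symmetry let \<open>z\<close> have the smaller norm. If both norms exceed
  \<open>R\<close>, the difference splits into two vectors of norm at most
  \<open>1 - R / norm z\<close> and \<open>R / norm z\<close> times \<open>norm (y - z)\<close>.
  Only the triangle inequality enters, so any norm will do.\<close>

lemma shrink_nonexpansive:
  assumes "R > 0"
  shows "norm (shrink R y - shrink R z) \<le> norm (y - z)"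
proof -
  have *: "norm (shrink R y - shrink R z) \<le> norm (y - z)" if le: "norm z \<le> norm y" for y z :: 'a
  proof (cases "norm z \<le> R")
    case True
    then show ?thesis
      using assms le norm_triangle_ineq2[of y z] by (simp add: shrink_eq_0 norm_shrink)
  next
    case False
    then have z: "norm z > R" and y: "norm y > R"
      using le by auto
    have "shrink R y - shrink R z = (1 - R / norm z) *\<^sub>R (y - z) + (R / norm z - R / norm y) *\<^sub>R y"
      using z y assms by (simp add: shrink_eq algebra_simps)
    then have "norm (shrink R y - shrink R z)
        \<le> norm ((1 - R / norm z) *\<^sub>R (y - z)) + norm ((R / norm z - R / norm y) *\<^sub>R y)"
      using norm_triangle_ineq by metis
    also have "\<dots> = (1 - R / norm z) * norm (y - z) + (R / norm z - R / norm y) * norm y"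
    proof -
      have "1 - R / norm z \<ge> 0" "R / norm z - R / norm y \<ge> 0"
        using z le assms by (auto simp: divide_le_eq_1 intro!: frac_le)
      then show ?thesis
        by simp
    qed
    also have "\<dots> = (1 - R / norm z) * norm (y - z) + R / norm z * (norm y - norm z)"
      using z y assms by (auto simp: field_simps)
    also have "\<dots> \<le> (1 - R / norm z) * norm (y - z) + R / norm z * norm (y - z)"
      using z assms by (intro add_left_mono mult_left_mono norm_triangle_ineq2) auto
    also have "\<dots> = norm (y - z)"
      by (simp add: algebra_simps)
    finally show ?thesis .
  qed
  show ?thesis
    using *[of y z] *[of z y] by (metis linear norm_minus_commute)
qed

lemma shrink_in_convex:
  assumes "convex C" "x \<in> C" "y \<in> C" "R > 0"
  shows "x + shrink R (y - x) \<in> C"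
proof -
  let ?u = "max 0 (1 - R / norm (y - x))"
  have "(1 - ?u) *\<^sub>R x + ?u *\<^sub>R y \<in> C"
    using assms by (intro convexD_alt) auto
  then show ?thesis
    by (simp add: shrink_def algebra_simps)
qed

text \<open>The two summands vary in disjoint regions: inside the \<open>R\<close>-ball about
  \<open>x\<close> only the cone changes, outside it only the composition with \<open>f\<close>.
  Across the boundary the two bounds add up to
  \<open>(norm (z - x) - R) + (R - norm (y - x))\<close>, which is at most
  \<open>norm (y - z)\<close>.\<close>

lemma add_cone_nonexpansive:
  fixes f :: "'a::real_normed_vector \<Rightarrow> 'a"
  assumes "R > 0" and "convex C" and "x \<in> C"
    and f: "\<And>y z. y \<in> C \<Longrightarrow> z \<in> C \<Longrightarrow> norm (f y - f z) \<le> norm (y - z)"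
    and v: "norm v \<le> 1" and "y \<in> C" "z \<in> C"
  defines "g \<equiv> \<lambda>y. f (x + shrink R (y - x)) + max 0 (R - norm (y - x)) *\<^sub>R v"
  shows "norm (g y - g z) \<le> norm (y - z)"
proof -
  define p where "p y = x + shrink R (y - x)" for y
  have pC: "p y \<in> C" if "y \<in> C" for y
    unfolding p_def using that assms by (intro shrink_in_convex) auto
  have px: "p y = x" if "norm (y - x) \<le> R" for y
    using that \<open>R > 0\<close> by (simp add: p_def shrink_eq_0)
  have fp: "norm (f (p y) - f (p z)) \<le> norm (p y - p z)" if "y \<in> C" "z \<in> C" for y z
    using that by (intro f pC)
  have pn: "norm (p y - p z) \<le> norm (y - z)" for y z
    using shrink_nonexpansive[OF \<open>R > 0\<close>, of "y - x" "z - x"] by (simp add: p_def)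
  have sv: "norm (t *\<^sub>R v) \<le> \<bar>t\<bar>" for t
    using mult_left_mono[OF v, of "\<bar>t\<bar>"] by simp
  have tri: "\<bar>norm (y - x) - norm (z - x)\<bar> \<le> norm (y - z)" for y z
    using norm_triangle_ineq3[of "y - x" "z - x"] by simp
  have mixed: "norm (g y - g z) \<le> norm (y - z)"
    if C: "y \<in> C" "z \<in> C" and y: "norm (y - x) \<le> R" and z: "R < norm (z - x)" for y z
  proof -
    have "g y - g z = (f (p y) - f (p z)) + (R - norm (y - x)) *\<^sub>R v"
      using y z by (simp add: g_def p_def)
    then have "norm (g y - g z) \<le> norm (f (p y) - f (p z)) + norm ((R - norm (y - x)) *\<^sub>R v)"
      using norm_triangle_ineq by metis
    also have "\<dots> \<le> norm (p y - p z) + (R - norm (y - x))"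
      using fp[OF C] sv[of "R - norm (y - x)"] y by simp
    also have "norm (p y - p z) = norm (z - x) - R"
      using norm_shrink[OF \<open>R > 0\<close>, of "z - x"] z y px[of y] by (simp add: p_def)
    finally show ?thesis
      using tri[of y z] by simp
  qed
  consider (inner) "norm (y - x) \<le> R" "norm (z - x) \<le> R"
    | (left) "norm (y - x) \<le> R" "R < norm (z - x)"
    | (right) "norm (z - x) \<le> R" "R < norm (y - x)"
    | (outer) "R < norm (y - x)" "R < norm (z - x)"
    by linarith
  then show ?thesis
  proof cases
    case inner
    then have "g y - g z = (norm (z - x) - norm (y - x)) *\<^sub>R v"
      using px[of y] px[of z] by (simp add: g_def p_def scaleR_diff_left)
    then show ?thesis
      using sv[of "norm (z - x) - norm (y - x)"] tri[of z y]
      by (simp add: norm_minus_commute[of z y])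
  next
    case left
    then show ?thesis
      using mixed \<open>y \<in> C\<close> \<open>z \<in> C\<close> by blast
  next
    case right
    then show ?thesis
      using mixed[of z y] \<open>y \<in> C\<close> \<open>z \<in> C\<close> by (simp add: norm_minus_commute)
  next
    case outer
    then have "g y - g z = f (p y) - f (p z)"
      by (simp add: g_def p_def)
    then show ?thesis
      using fp[OF \<open>y \<in> C\<close> \<open>z \<in> C\<close>] pn[of y z] by simp
  qed
qed

section \<open>Room for moving inside a convex set\<close>

lemma not_singleton_far_point:
  fixes C :: "'a::real_normed_vector set"
  assumes "C \<noteq> {}" "\<not> is_singleton C"
  obtains d where "d > 0" "\<And>p. \<exists>w\<in>C. d \<le> norm (w - p)"
proof -
  obtain u v where uv: "u \<in> C" "v \<in> C" "u \<noteq> v"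
    using assms by (metis is_singletonI')
  \<comment> \<open>No \<open>p\<close> is closer than half the distance of \<open>u\<close> and
    \<open>v\<close> to both of them. Thus one \<open>d\<close> serves all centres, later both
    \<open>x\<close> and \<open>f x\<close>.\<close>
  have "norm (u - v) / 2 \<le> norm (u - p) \<or> norm (u - v) / 2 \<le> norm (v - p)" for p
    using norm_triangle_ineq4[of "u - p" "v - p"] by auto
  then show thesis
    using uv that[of "norm (u - v) / 2"] by auto
qed

lemma convex_move_towards:
  assumes "convex C" "p \<in> C" "w \<in> C" "0 \<le> s" "s \<le> norm (w - p)"
  shows "p + s *\<^sub>R sgn (w - p) \<in> C"
proof (cases "w = p")
  case False
  let ?u = "s / norm (w - p)"
  have "(1 - ?u) *\<^sub>R p + ?u *\<^sub>R w \<in> C"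
    using assms False by (intro convexD_alt) auto
  then show ?thesis
    by (simp add: sgn_div_norm algebra_simps divide_inverse)
qed (use assms in simp)

lemma nonexpansive_near_isometric_at_scale:
  fixes C :: "'a::real_normed_vector set"
  assumes "convex C" "x \<in> C" and fM: "f \<in> nonexpansive_maps C"
    and "R > 0" and w: "w \<in> C" "R \<le> norm (w - f x)"
  obtains g where "g \<in> nonexpansive_maps C" "\<And>y. y \<in> C \<Longrightarrow> norm (g y - f y) \<le> 2 * R"
    "\<And>y. y \<in> C \<Longrightarrow> norm (y - x) = R \<Longrightarrow> norm (g y - g x) = R"
proof -
  define v where "v = sgn (w - f x)"
  have v: "norm v = 1"
    using \<open>R > 0\<close> w by (auto simp: v_def norm_sgn)
  have fC: "f y \<in> C" if "y \<in> C" for y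
    using fM that by (auto simp: nonexpansive_maps_def)
  have f: "norm (f y - f z) \<le> norm (y - z)" if "y \<in> C" "z \<in> C" for y z
    using fM that by (auto simp: nonexpansive_maps_def)
  define p where "p y = x + shrink R (y - x)" for y
  \<comment> \<open>Elements of \<open>nonexpansive_maps C\<close> have to be
    \<open>undefined\<close> off \<open>C\<close>, hence \<open>restrict\<close>.\<close>
  define g where "g = restrict (\<lambda>y. f (p y) + max 0 (R - norm (y - x)) *\<^sub>R v) C"
  have pC: "p y \<in> C" if "y \<in> C" for y
    unfolding p_def using that assms by (intro shrink_in_convex) auto
  have px: "p y = x" if "norm (y - x) \<le> R" for y
    using that \<open>R > 0\<close> by (simp add: p_def shrink_eq_0)
  have "norm (g y - g z) \<le> norm (y - z)" if "y \<in> C" "z \<in> C" for y z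
    using add_cone_nonexpansive[OF \<open>R > 0\<close> assms(1,2) f, of v y z] that v
    by (simp add: g_def p_def)
  moreover have "g y \<in> C" if "y \<in> C" for y
  proof (cases "norm (y - x) \<le> R")
    case True
    \<comment> \<open>The value lies on the segment from \<open>f x\<close> to \<open>w\<close>, as
      the cone height is at most \<open>R\<close> and \<open>w\<close> is at least that far from
      \<open>f x\<close>.\<close>
    have "f x + (R - norm (y - x)) *\<^sub>R v \<in> C"
      unfolding v_def using True assms fC norm_ge_zero[of "y - x"]
      by (intro convex_move_towards) (auto intro: order_trans[OF _ w(2)])
    then show ?thesis
      using True px that by (simp add: g_def)
  next
    case False
    then show ?thesis
      using that fC pC by (simp add: g_def)
  qed
  ultimately have gM: "g \<in> nonexpansive_maps C"
    by (auto simp: nonexpansive_maps_def g_def)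
  have close: "norm (g y - f y) \<le> 2 * R" if "y \<in> C" for y
  proof -
    have "g y - f y = (f (p y) - f y) + max 0 (R - norm (y - x)) *\<^sub>R v"
      using that by (simp add: g_def)
    then have "norm (g y - f y) \<le> norm (f (p y) - f y) + norm (max 0 (R - norm (y - x)) *\<^sub>R v)"
      using norm_triangle_ineq by metis
    moreover have "norm (f (p y) - f y) \<le> R"
      using f[OF pC[OF that] that] norm_shrink_diff_self[OF \<open>R > 0\<close>, of "y - x"]
      by (simp add: p_def algebra_simps)
    moreover have "norm (max 0 (R - norm (y - x)) *\<^sub>R v) \<le> R"
      using v \<open>R > 0\<close> by simp
    ultimately show ?thesis
      by simp
  qed
  \<comment> \<open>Both points collapse to \<open>x\<close>, while the cone has height
    \<open>R\<close> at \<open>x\<close> and 0 at \<open>y\<close>; so the difference is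
    \<open>- R *\<^sub>R v\<close>.\<close>
  have "norm (g y - g x) = R" if "y \<in> C" "norm (y - x) = R" for y
    using that \<open>x \<in> C\<close> \<open>R > 0\<close> v px[of y] px[of x] by (simp add: g_def)
  with gM close show thesis
    by (rule that)
qed

section \<open>Lower porosity of one piece\<close>

lemma lower_porous_small_quotients:
  fixes C :: "'a::real_normed_vector set"
  assumes "bounded C" "convex C" "C \<noteq> {}" "\<not> is_singleton C" "x \<in> C"
    and "\<delta> > 0" "0 \<le> a" "a < 1"
  shows "lower_porous (nonexpansive_space C)
    {f \<in> nonexpansive_maps C. \<forall>y\<in>C. norm (y - x) \<le> \<delta> \<longrightarrow> norm (f y - f x) \<le> a * norm (y - x)}"
    (is "lower_porous ?M ?P")
  unfolding lower_porous_def
proof (intro conjI ballI)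
  show "?P \<subseteq> mspace ?M"
    using assms by (auto simp: mspace_nonexpansive_space)
next
  fix f assume "f \<in> ?P"
  then have fM: "f \<in> nonexpansive_maps C"
    by blast
  obtain d where "d > 0" and d: "\<And>p. \<exists>w\<in>C. d \<le> norm (w - p)"
    using not_singleton_far_point assms(3,4) by blast
  have M: "mspace ?M = nonexpansive_maps C"
    using assms by (simp add: mspace_nonexpansive_space)
  show "lower_porous_at ?M ?P f"
  proof (rule lower_porous_atI)
    \<comment> \<open>With \<open>r = 3 * R\<close> the hole has radius
      \<open>(1 - a) / 2 * R\<close>. The threshold keeps \<open>R\<close> below
      \<open>\<delta>\<close>, where the quotient bound applies, and below \<open>d\<close>, where
      there is room for the cone.\<close>
    show "(1 - a) / 6 > 0" "min \<delta> d > 0"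
      using assms \<open>d > 0\<close> by auto
  next
    fix r :: real assume r: "0 < r" "r \<le> min \<delta> d"
    \<comment> \<open>The perturbation costs \<open>2 * R\<close> and the hole radius is at most
      \<open>R\<close>, so the hole fits into a ball of radius \<open>3 * R\<close>.\<close>
    define R where "R = r / 3"
    have R: "0 < R" "R \<le> \<delta>" "R \<le> d" "r = 3 * R"
      using r by (auto simp: R_def)
    obtain w where w: "w \<in> C" "R \<le> norm (w - f x)"
      using d[of "f x"] R by force
    obtain u where u: "u \<in> C" "R \<le> norm (u - x)"
      using d[of x] R by force
    define y where "y = x + R *\<^sub>R sgn (u - x)"
    have yC: "y \<in> C"
      unfolding y_def using assms u R by (intro convex_move_towards) auto
    have yR: "norm (y - x) = R"
      using u R by (auto simp: y_def norm_sgn)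
    obtain g where g: "g \<in> nonexpansive_maps C" "\<And>y. y \<in> C \<Longrightarrow> norm (g y - f y) \<le> 2 * R"
      "\<And>y. y \<in> C \<Longrightarrow> norm (y - x) = R \<Longrightarrow> norm (g y - g x) = R"
      using nonexpansive_near_isometric_at_scale[OF assms(2,5) fM R(1) w] by metis
    have dfg: "mdist ?M f g \<le> 2 * R"
      using assms fM g by (intro mdist_nonexpansive_space_le) auto
    have "h \<in> mball_of ?M f r - ?P" if "h \<in> mball_of ?M g ((1 - a) / 6 * r)" for h
    proof -
      have hM: "h \<in> nonexpansive_maps C" and gh: "mdist ?M g h < (1 - a) / 2 * R"
        using that M R by (simp_all add: mult.commute)
      have "mdist ?M f h \<le> mdist ?M f g + mdist ?M g h"
        using fM g hM M by (intro mdist_triangle) auto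
      moreover have "(1 - a) / 2 * R \<le> 1 * R"
        using assms R by (intro mult_right_mono) auto
      ultimately have "mdist ?M f h < r"
        using dfg gh R by linarith
      moreover have "h \<notin> ?P"
      proof
        assume "h \<in> ?P"
        then have "norm (h y - h x) \<le> a * R"
          using yC yR R by auto
        moreover have "norm (h y - g y) < (1 - a) / 2 * R" "norm (h x - g x) < (1 - a) / 2 * R"
          using norm_le_mdist_nonexpansive_space[OF assms(1) g(1) hM] gh yC assms(5)
          by (meson le_less_trans)+
        \<comment> \<open>Passing from \<open>g\<close> to \<open>h\<close> costs less than
          \<open>(1 - a) / 2 * R\<close> at each of the two points, so
          \<open>norm (g y - g x)\<close> would be less than \<open>R\<close>.\<close>
        moreover have "norm (g y - g x) \<le> norm (h y - h x) + norm (h y - g y) + norm (h x - g x)"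
          by norm
        ultimately show False
          using g(3)[OF yC yR] by (simp add: field_simps)
      qed
      ultimately show ?thesis
        using fM hM M by simp
    qed
    then show "\<exists>g\<in>mspace ?M. mball_of ?M g ((1 - a) / 6 * r) \<subseteq> mball_of ?M f r - ?P"
      using g(1) M by blast
  qed
qed

section \<open>Countable decomposition\<close>

lemma Lip_less_1_iff:
  "Lip C f x < 1 \<longleftrightarrow>
    (\<exists>k. \<forall>y\<in>C. norm (y - x) \<le> inverse (Suc k) \<longrightarrow>
      norm (f y - f x) \<le> (1 - inverse (Suc k)) * norm (y - x))"
    (is "_ \<longleftrightarrow> (\<exists>k. ?Q k)")
proof
  assume "Lip C f x < 1"
  then obtain a where a: "Lip C f x < ereal a" "a < 1"
    by (metis ereal_dense2 ereal_less(3) one_ereal_def)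
  then have "\<forall>\<^sub>F r in at_right 0. Lip_quot_sup C f x r < ereal a"
    using tendsto_Lip order_tendstoD(2) by blast
  then obtain b where b: "b > 0" "\<And>r. 0 < r \<Longrightarrow> r < b \<Longrightarrow> Lip_quot_sup C f x r < ereal a"
    unfolding eventually_at_right_field by blast
  \<comment> \<open>A single index controls both the radius (below \<open>b\<close>) and the gap to
    1 (below \<open>1 - a\<close>), so countably many conditions suffice.\<close>
  obtain k where k: "inverse (real (Suc k)) < min b (1 - a)"
    using reals_Archimedean[of "min b (1 - a)"] a b by auto
  have "norm (f y - f x) \<le> (1 - inverse (Suc k)) * norm (y - x)"
    if y: "y \<in> C" "norm (y - x) \<le> inverse (Suc k)" for y
  proof (cases "y = x")
    case False
    have "ereal (norm (f y - f x) / norm (y - x)) \<le> Lip_quot_sup C f x (inverse (Suc k))"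
      unfolding Lip_quot_sup_def using y False by (intro Sup_upper) auto
    also have "\<dots> < ereal a"
      using k by (intro b) auto
    finally have "norm (f y - f x) / norm (y - x) \<le> 1 - inverse (Suc k)"
      using k by simp
    then show ?thesis
      using False by (simp add: pos_divide_le_eq)
  qed simp
  then show "\<exists>k. ?Q k"
    by blast
next
  assume "\<exists>k. ?Q k"
  then obtain k where k: "?Q k"
    by blast
  \<comment> \<open>This includes the case of no admissible \<open>y\<close>, where the supremum is
    minus infinity.\<close>
  have "Lip_quot_sup C f x r \<le> ereal (1 - inverse (Suc k))" if "r < inverse (Suc k)" for r
    unfolding Lip_quot_sup_def
  proof (rule Sup_least)
    fix q assume "q \<in> {ereal (norm (f y - f x) / norm (y - x)) |y.
      y \<in> C \<and> 0 < norm (y - x) \<and> norm (y - x) \<le> r}"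
    then obtain y where "q = ereal (norm (f y - f x) / norm (y - x))"
      "y \<in> C" "0 < norm (y - x)" "norm (y - x) \<le> r"
      by blast
    then show "q \<le> ereal (1 - inverse (Suc k))"
      using k that by (simp add: pos_divide_le_eq)
  qed
  moreover have "inverse (real (Suc k)) > 0"
    by simp
  ultimately have "\<forall>\<^sub>F r in at_right 0. Lip_quot_sup C f x r \<le> ereal (1 - inverse (Suc k))"
    unfolding eventually_at_right_field by blast
  then have "Lip C f x \<le> ereal (1 - inverse (Suc k))"
    by (intro tendsto_upperbound[OF tendsto_Lip]) auto
  also have "\<dots> < 1"
    by (simp add: one_ereal_def)
  finally show "Lip C f x < 1" .
qed

theorem theorem4p2:
  fixes C :: "'a::banach set" and x :: 'a
  assumes "bounded C" and "convex C" and "C \<noteq> {}" and "\<not> is_singleton C"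
    and "x \<in> C"
  shows "sigma_lower_porous (nonexpansive_space C)
           {f \<in> mspace (nonexpansive_space C). Lip C f x < 1}"
proof -
  define P where "P k = {f \<in> nonexpansive_maps C. \<forall>y\<in>C. norm (y - x) \<le> inverse (Suc k) \<longrightarrow>
    norm (f y - f x) \<le> (1 - inverse (Suc k)) * norm (y - x)}" for k
  \<comment> \<open>This makes the constant \<open>a = 1 - inverse (Suc k)\<close> nonnegative; it
    is 0 for \<open>k = 0\<close>.\<close>
  have "inverse (real (Suc k)) \<le> 1" for k
    by (simp add: field_simps)
  then have "lower_porous (nonexpansive_space C) (P k)" for k
    unfolding P_def using assms by (intro lower_porous_small_quotients) auto
  moreover have "{f \<in> mspace (nonexpansive_space C). Lip C f x < 1} = (\<Union>k. P k)"
    using assms(1) by (auto simp: P_def mspace_nonexpansive_space Lip_less_1_iff)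
  ultimately show ?thesis
    unfolding sigma_lower_porous_def by (intro exI[of _ "range P"]) auto
qed

end
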